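(* Let $n \geq 3$ and $d \geq 2$, and let $V(n,d)$ be the number of vertices of $\Omega_n^d$. Then $$V(n,d) \leq \binom{n^d - \lfloor \frac{(n-1)^d+1}{2} \rfloor}{n^d - (n-1)^d} + \binom{n^d - \lfloor \frac{(n-1)^d+2}{2} \rfloor}{n^d - (n-1)^d}.$$
   Context: For integers $n,d \geq 1$ let $I_n^d = \{\alpha = (\alpha_1,\ldots,\alpha_d) : \alpha_i \in \{1,\ldots,n\}\}$. A $d$-dimensional matrix of order $n$ is an array $A = (a_\alpha)_{\alpha \in I_n^d}$ of real numbers, viewed as a point of $\mathbb{R}^{n^d}$. A line of $A$ is the set of entries obtained by fixing all but one coordinate of the index and letting the remaining coordinate range over $\{1,\ldots,n\}$. A matrix is polystochastic if all its entries are nonnegative and the sum of entries in each line equals $1$. $\Omega_n^d$ denotes the convex polytope of all $d$-dimensional polystochastic matrices of order $n$; a vertex of $\Omega_n^d$ is an extreme point of it. *)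

theory Defs
  imports Complex_Main "HOL-Library.FuncSet"
begin

definition index_set :: "nat \<Rightarrow> nat \<Rightarrow> (nat \<Rightarrow> nat) set" where
  "index_set n d = PiE {1..d} (\<lambda>_. {1..n})"

definition matrices :: "nat \<Rightarrow> nat \<Rightarrow> ((nat \<Rightarrow> nat) \<Rightarrow> real) set" where
  "matrices n d = {A. \<forall>\<alpha>. \<alpha> \<notin> index_set n d \<longrightarrow> A \<alpha> = 0}"

definition polystochastic :: "nat \<Rightarrow> nat \<Rightarrow> ((nat \<Rightarrow> nat) \<Rightarrow> real) \<Rightarrow> bool" where
  "polystochastic n d A \<longleftrightarrow> A \<in> matrices n d \<and>
     (\<forall>\<alpha>\<in>index_set n d. 0 \<le> A \<alpha>) \<and>
     (\<forall>\<alpha>\<in>index_set n d. \<forall>k\<in>{1..d}. (\<Sum>i\<in>{1..n}. A (\<alpha>(k := i))) = 1)"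

definition Omega :: "nat \<Rightarrow> nat \<Rightarrow> ((nat \<Rightarrow> nat) \<Rightarrow> real) set" where
  "Omega n d = {A. polystochastic n d A}"

definition extreme_pt :: "((nat \<Rightarrow> nat) \<Rightarrow> real) set \<Rightarrow> ((nat \<Rightarrow> nat) \<Rightarrow> real) \<Rightarrow> bool" where
  "extreme_pt S A \<longleftrightarrow> A \<in> S \<and>
     \<not> (\<exists>B\<in>S. \<exists>C\<in>S. B \<noteq> C \<and>
          (\<exists>t::real. 0 < t \<and> t < 1 \<and> A = (\<lambda>\<alpha>. t * B \<alpha> + (1 - t) * C \<alpha>)))"

definition num_vertices :: "nat \<Rightarrow> nat \<Rightarrow> nat" where
  "num_vertices n d = card {A. extreme_pt (Omega n d) A}"

end

(*
  The bound is McMullen's upper bound for a polytope of dimension D = (n - 1)^d cut out by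
  N = n^d inequalities, and it follows from the skew version of Bollobas' set-pair inequality.
  Order the vertices by a generic linear functional c. At a vertex w choose D vanishing
  coordinates Z whose restrictions to the polytope form an affine coordinate system, so that
  c(x) - c(w) = sum of r_j x_j over j in Z, and split Z into R = {j. r_j < 0} and its complement.
  On the face where the coordinates in R vanish c is minimised at w, hence the support of every
  vertex below w meets R; supports have at most N - D elements. Vertices with |R| <= D/2 are
  therefore at most binomial(N - D + floor(D/2), N - D) many, and the remaining ones are
  handled by -c and Z - R. No nondegeneracy of the polytope is needed.
*)

theory Submission
  imports Defs "HOL-Computational_Algebra.Polynomial"
begin

section \<open>Linear algebra: dependences, bases and generic functionals\<close>

text \<open>Gaussian elimination, one coordinate of \<open>S\<close> at a time: a pivot with a
  nonzero entry at \<open>s\<close> clears that coordinate from the other vectors. This costs one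
  vector and one coordinate, so the strict inequality of cardinalities survives.\<close>

lemma nontrivial_dependence:
  fixes u :: "'i \<Rightarrow> 's \<Rightarrow> 'f :: field"
  assumes "finite S" "finite I" "card S < card I"
  shows "\<exists>c. (\<exists>i\<in>I. c i \<noteq> 0) \<and> (\<forall>s\<in>S. (\<Sum>i\<in>I. c i * u i s) = 0)"
  using assms
proof (induction S arbitrary: I u rule: finite_induct)
  case empty
  then obtain i where "i \<in> I" by fastforce
  then show ?case by (intro exI[of _ "\<lambda>_. 1"]) auto
next
  case (insert s S)
  show ?case
  proof (cases "\<forall>i\<in>I. u i s = 0")
    case True
    have "card S < card I" using insert by simp
    from insert.IH[OF insert.prems(1) this, of u] True show ?thesis by auto
  next
    case False
    then obtain p where p: "p \<in> I" "u p s \<noteq> 0" by blast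
    define J where "J = I - {p}"
    define w where "w = (\<lambda>i s'. u i s' - u i s / u p s * u p s')"
    have "finite J" "card S < card J"
      using insert p by (auto simp: J_def)
    from insert.IH[OF this, of w] obtain c where
      c: "\<exists>i\<in>J. c i \<noteq> 0" "\<forall>s'\<in>S. (\<Sum>i\<in>J. c i * w i s') = 0" by blast
    \<comment> \<open>The coefficient of the pivot collects all multiples of \<open>u p\<close> that
      were subtracted in passing from \<open>u\<close> to \<open>w\<close>.\<close>
    define c' where "c' = c(p := - (\<Sum>i\<in>J. c i * (u i s / u p s)))"
    have eq: "(\<Sum>i\<in>I. c' i * u i s') = (\<Sum>i\<in>J. c i * w i s')" for s'
    proof -
      have "(\<Sum>i\<in>I. c' i * u i s') = c' p * u p s' + (\<Sum>i\<in>J. c' i * u i s')"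
        unfolding J_def using insert.prems(1) p(1) by (rule sum.remove)
      also have "(\<Sum>i\<in>J. c' i * u i s') = (\<Sum>i\<in>J. c i * u i s')"
        by (rule sum.cong) (auto simp: c'_def J_def)
      finally show ?thesis
        by (simp add: c'_def w_def algebra_simps sum_subtractf sum_distrib_left)
    qed
    have "w i s = 0" for i using p by (simp add: w_def)
    then have "\<forall>s'\<in>insert s S. (\<Sum>i\<in>I. c' i * u i s') = 0"
      using c(2) by (auto simp: eq)
    moreover have "\<exists>i\<in>I. c' i \<noteq> 0"
      using c(1) by (auto simp: c'_def J_def)
    ultimately show ?thesis by blast
  qed
qed

text \<open>\<open>total\<close> says that only the zero vector is annihilated by all functionals
  \<open>\<phi> \<alpha>\<close>, so these span the dual of the space over \<open>K\<close>. A
  maximal independent subfamily is therefore a basis of that dual; its size follows by counting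
  dependences in both directions.\<close>

lemma basis_selection:
  fixes \<phi> :: "'a \<Rightarrow> 'k \<Rightarrow> 'f :: field"
  assumes "finite K" "finite F"
    and total: "\<forall>y. (\<forall>\<alpha>\<in>F. (\<Sum>\<kappa>\<in>K. y \<kappa> * \<phi> \<alpha> \<kappa>) = 0) \<longrightarrow> (\<forall>\<kappa>\<in>K. y \<kappa> = 0)"
  shows "\<exists>Z\<subseteq>F. card Z = card K \<and>
    (\<forall>c. \<exists>r. \<forall>\<kappa>\<in>K. c \<kappa> = (\<Sum>\<alpha>\<in>Z. r \<alpha> * \<phi> \<alpha> \<kappa>))"
proof -
  define indep where "indep = (\<lambda>Z. \<forall>r. (\<forall>\<kappa>\<in>K. (\<Sum>\<alpha>\<in>Z. r \<alpha> * \<phi> \<alpha> \<kappa>) = 0) \<longrightarrow> (\<forall>\<alpha>\<in>Z. r \<alpha> = 0))"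
  have indepD: "\<forall>\<alpha>\<in>Y. r \<alpha> = 0" if "indep Y" "\<forall>\<kappa>\<in>K. (\<Sum>\<alpha>\<in>Y. r \<alpha> * \<phi> \<alpha> \<kappa>) = 0" for Y r
    using that by (simp add: indep_def)
  have "finite {Z. Z \<subseteq> F \<and> indep Z}" "{} \<in> {Z. Z \<subseteq> F \<and> indep Z}"
    using assms(2) by (auto simp: indep_def)
  from finite_has_maximal2[OF this] obtain Z where "Z \<in> {Z. Z \<subseteq> F \<and> indep Z}"
    and maximal: "\<forall>Y\<in>{Z. Z \<subseteq> F \<and> indep Z}. Z \<subseteq> Y \<longrightarrow> Z = Y" by (elim bexE conjE)
  then have Z: "Z \<subseteq> F" "indep Z" by simp_all
  have finZ: "finite Z" using Z(1) assms(2) finite_subset by blast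
  have span: "\<exists>r. \<forall>\<kappa>\<in>K. c \<kappa> = (\<Sum>\<alpha>\<in>Z. r \<alpha> * \<phi> \<alpha> \<kappa>)"
    if "b \<noteq> 0" and rel: "\<forall>\<kappa>\<in>K. b * c \<kappa> + (\<Sum>\<alpha>\<in>Z. r \<alpha> * \<phi> \<alpha> \<kappa>) = 0" for b c r
  proof (intro exI ballI)
    fix \<kappa> assume "\<kappa> \<in> K"
    with rel have "b * c \<kappa> = - (\<Sum>\<alpha>\<in>Z. r \<alpha> * \<phi> \<alpha> \<kappa>)" by (simp add: eq_neg_iff_add_eq_0)
    then have "c \<kappa> = - (\<Sum>\<alpha>\<in>Z. r \<alpha> * \<phi> \<alpha> \<kappa>) / b" using \<open>b \<noteq> 0\<close>
      by (metis nonzero_mult_div_cancel_left)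
    then show "c \<kappa> = (\<Sum>\<alpha>\<in>Z. (- r \<alpha> / b) * \<phi> \<alpha> \<kappa>)"
      by (simp add: sum_divide_distrib sum_negf)
  qed
  have span_F: "\<exists>r. \<forall>\<kappa>\<in>K. \<phi> \<beta> \<kappa> = (\<Sum>\<alpha>\<in>Z. r \<alpha> * \<phi> \<alpha> \<kappa>)" if "\<beta> \<in> F" for \<beta>
  proof (cases "\<beta> \<in> Z")
    case True
    have "(\<Sum>\<alpha>\<in>Z. (if \<alpha> = \<beta> then 1 else 0) * \<phi> \<alpha> \<kappa>) = (\<Sum>\<alpha>\<in>Z. if \<alpha> = \<beta> then \<phi> \<alpha> \<kappa> else 0)" for \<kappa>
      by (rule sum.cong) auto
    then have "\<phi> \<beta> \<kappa> = (\<Sum>\<alpha>\<in>Z. (if \<alpha> = \<beta> then 1 else 0) * \<phi> \<alpha> \<kappa>)" for \<kappa>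
      using True finZ by simp
    then show ?thesis by (intro exI ballI)
  next
    case False
    then have "\<not> indep (insert \<beta> Z)" using bspec[OF maximal, of "insert \<beta> Z"] Z(1) that by auto
    then obtain r where rel: "\<forall>\<kappa>\<in>K. (\<Sum>\<alpha>\<in>insert \<beta> Z. r \<alpha> * \<phi> \<alpha> \<kappa>) = 0"
      and nz: "\<not> (\<forall>\<alpha>\<in>insert \<beta> Z. r \<alpha> = 0)"
      unfolding indep_def not_all not_imp by (elim exE conjE)
    from rel have r: "\<forall>\<kappa>\<in>K. r \<beta> * \<phi> \<beta> \<kappa> + (\<Sum>\<alpha>\<in>Z. r \<alpha> * \<phi> \<alpha> \<kappa>) = 0"
      using False finZ by simp
    have "r \<beta> \<noteq> 0"
    proof
      assume "r \<beta> = 0"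
      with r have "\<forall>\<alpha>\<in>Z. r \<alpha> = 0" by (intro indepD[OF Z(2)]) simp
      with nz \<open>r \<beta> = 0\<close> show False by auto
    qed
    from span[OF this r] show ?thesis .
  qed
  have le: "card Z \<le> card K"
  proof (rule ccontr)
    assume "\<not> card Z \<le> card K"
    then have "card K < card Z" by simp
    from nontrivial_dependence[OF assms(1) finZ this, of \<phi>] obtain r where
      r: "\<exists>\<alpha>\<in>Z. r \<alpha> \<noteq> 0" "\<forall>\<kappa>\<in>K. (\<Sum>\<alpha>\<in>Z. r \<alpha> * \<phi> \<alpha> \<kappa>) = 0" by blast
    from indepD[OF Z(2) r(2)] r(1) show False by blast
  qed
  \<comment> \<open>With fewer functionals than coordinates some nonzero \<open>y\<close> is
    annihilated by \<open>Z\<close>, hence by all of \<open>F\<close> through \<open>span_F\<close>,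
    against \<open>total\<close>.\<close>
  have ge: "card K \<le> card Z"
  proof (rule ccontr)
    assume "\<not> card K \<le> card Z"
    then have "card Z < card K" by simp
    from nontrivial_dependence[OF finZ assms(1) this, of "\<lambda>\<kappa> \<alpha>. \<phi> \<alpha> \<kappa>"] obtain y where
      y: "\<exists>\<kappa>\<in>K. y \<kappa> \<noteq> 0" "\<forall>\<alpha>\<in>Z. (\<Sum>\<kappa>\<in>K. y \<kappa> * \<phi> \<alpha> \<kappa>) = 0" by blast
    have "(\<Sum>\<kappa>\<in>K. y \<kappa> * \<phi> \<beta> \<kappa>) = 0" if \<beta>: "\<beta> \<in> F" for \<beta>
    proof -
      from span_F[OF \<beta>] obtain r where
        r: "\<forall>\<kappa>\<in>K. \<phi> \<beta> \<kappa> = (\<Sum>\<alpha>\<in>Z. r \<alpha> * \<phi> \<alpha> \<kappa>)" by blast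
      have "(\<Sum>\<kappa>\<in>K. y \<kappa> * \<phi> \<beta> \<kappa>) = (\<Sum>\<kappa>\<in>K. \<Sum>\<alpha>\<in>Z. r \<alpha> * (y \<kappa> * \<phi> \<alpha> \<kappa>))"
        by (rule sum.cong) (auto simp: r sum_distrib_left mult_ac)
      also have "\<dots> = (\<Sum>\<alpha>\<in>Z. r \<alpha> * (\<Sum>\<kappa>\<in>K. y \<kappa> * \<phi> \<alpha> \<kappa>))"
        by (subst sum.swap) (simp add: sum_distrib_left)
      finally show ?thesis using y(2) by simp
    qed
    then have "\<forall>\<kappa>\<in>K. y \<kappa> = 0" by (intro spec[OF total, THEN mp] ballI)
    with y(1) show False by blast
  qed
  have "\<exists>r. \<forall>\<kappa>\<in>K. c \<kappa> = (\<Sum>\<alpha>\<in>Z. r \<alpha> * \<phi> \<alpha> \<kappa>)" for c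
  proof -
    \<comment> \<open>Together with the family \<open>Z\<close>, \<open>c\<close> makes one vector
      too many, so a dependence exists. The tag \<open>None\<close> keeps \<open>c\<close> a
      separate member even if it equals some \<open>\<phi> \<alpha>\<close>.\<close>
    define u where "u = (\<lambda>q. case q of None \<Rightarrow> c | Some \<alpha> \<Rightarrow> \<phi> \<alpha>)"
    define Q where "Q = insert None (Some ` Z)"
    have "finite Q" "card K < card Q"
      using finZ le ge by (auto simp: Q_def card_insert_if card_image)
    from nontrivial_dependence[OF assms(1) this, of u] obtain b where
      b: "\<exists>q\<in>Q. b q \<noteq> 0" "\<forall>\<kappa>\<in>K. (\<Sum>q\<in>Q. b q * u q \<kappa>) = 0" by blast
    have r: "\<forall>\<kappa>\<in>K. b None * c \<kappa> + (\<Sum>\<alpha>\<in>Z. b (Some \<alpha>) * \<phi> \<alpha> \<kappa>) = 0"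
      using b(2) finZ by (auto simp: Q_def u_def sum.reindex)
    have "b None \<noteq> 0"
    proof
      assume "b None = 0"
      with r have "\<forall>\<alpha>\<in>Z. b (Some \<alpha>) = 0" by (intro indepD[OF Z(2)]) simp
      with b(1) \<open>b None = 0\<close> show False by (auto simp: Q_def)
    qed
    from span[OF this r] show ?thesis .
  qed
  with Z(1) le ge show ?thesis by (intro exI[of _ Z]) auto
qed

text \<open>The functional is a point \<open>t ^ e \<alpha>\<close> of the moment curve. As the
  exponents are distinct, each \<open>w\<close> becomes a nonzero polynomial in \<open>t\<close>,
  and finitely many such polynomials have only finitely many roots to avoid.\<close>

lemma generic_functional:
  fixes W :: "('a \<Rightarrow> real) set"
  assumes "finite I" "finite W" and nz: "\<And>w. w \<in> W \<Longrightarrow> \<exists>\<alpha>\<in>I. w \<alpha> \<noteq> 0"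
  shows "\<exists>c. \<forall>w\<in>W. (\<Sum>\<alpha>\<in>I. c \<alpha> * w \<alpha>) \<noteq> 0"
proof -
  obtain e :: "'a \<Rightarrow> nat" where e: "inj_on e I"
    using finite_imp_inj_to_nat_seg[OF assms(1)] by metis
  define p where "p = (\<lambda>w. \<Sum>\<alpha>\<in>I. monom (w \<alpha>) (e \<alpha>) :: real poly)"
  have "p w \<noteq> 0" if "w \<in> W" for w
  proof -
    obtain \<beta> where \<beta>: "\<beta> \<in> I" "w \<beta> \<noteq> 0" using nz \<open>w \<in> W\<close> by blast
    have "coeff (p w) (e \<beta>) = (\<Sum>\<alpha>\<in>I. if e \<alpha> = e \<beta> then w \<alpha> else 0)"
      by (simp add: p_def coeff_sum)
    also have "\<dots> = (\<Sum>\<alpha>\<in>I. if \<alpha> = \<beta> then w \<alpha> else 0)"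
      using e \<beta>(1) by (intro sum.cong) (auto simp: inj_on_def)
    also have "\<dots> = w \<beta>" using \<beta>(1) assms(1) by simp
    finally show ?thesis using \<beta>(2) by auto
  qed
  then have "finite (\<Union>w\<in>W. {t. poly (p w) t = 0})"
    using assms(2) poly_roots_finite by blast
  then obtain t :: real where t: "t \<notin> (\<Union>w\<in>W. {t. poly (p w) t = 0})"
    using ex_new_if_finite infinite_UNIV_char_0 by blast
  have "poly (p w) t = (\<Sum>\<alpha>\<in>I. t ^ e \<alpha> * w \<alpha>)" for w
    by (simp add: p_def poly_sum poly_monom mult.commute)
  with t show ?thesis by (intro exI[of _ "\<lambda>\<alpha>. t ^ e \<alpha>"]) auto
qed

section \<open>The skew Bollobas inequality by the polynomial method\<close>

text \<open>Each factor is linear in the coefficients of \<open>q\<close>, so the product is a form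
  of degree \<open>size T\<close> in them, with monomials indexed by multisets of exponents. What
  matters is that \<open>u\<close> is chosen before \<open>q\<close>: the products for different
  \<open>T\<close> become vectors in one finite-dimensional space.\<close>

lemma prod_poly_expansion:
  fixes T :: "'f :: comm_ring_1 multiset"
  shows "\<exists>u. \<forall>q. degree q \<le> M \<longrightarrow>
    (\<Prod>t\<in>#T. poly q t) = (\<Sum>X\<in>multisets_of_size {..M} (size T). u X * (\<Prod>i\<in>#X. coeff q i))"
proof (induction T)
  case empty
  show ?case by (intro exI[of _ "\<lambda>_. 1"]) simp
next
  case (add t T)
  define E where "E = multisets_of_size {..M}"
  define S where "S = {..M} \<times> E (size T)"
  from add.IH obtain u where u: "\<And>q. degree q \<le> M \<Longrightarrow>
    (\<Prod>t\<in>#T. poly q t) = (\<Sum>X\<in>E (size T). u X * (\<Prod>i\<in>#X. coeff q i))"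
    unfolding E_def by blast
  define h where "h = (\<lambda>z. case z of (i, X) \<Rightarrow> t ^ i * u X)"
  define g where "g = (\<lambda>z. case z of (i, X) \<Rightarrow> add_mset (i :: nat) X)"
  \<comment> \<open>Different pairs \<open>(i, X)\<close> can give the same multiset, so their
    contributions are collected over the fibres of \<open>g\<close>.\<close>
  define u' where "u' = (\<lambda>Y. \<Sum>z\<in>{z\<in>S. g z = Y}. h z)"
  have fin: "finite S" "finite (E (Suc (size T)))" by (auto simp: S_def E_def)
  have img: "g ` S \<subseteq> E (Suc (size T))"
    by (auto simp: S_def g_def E_def multisets_of_size_def)
  have "(\<Prod>t\<in>#add_mset t T. poly q t) = (\<Sum>Y\<in>E (Suc (size T)). u' Y * (\<Prod>i\<in>#Y. coeff q i))"
    if q: "degree q \<le> M" for q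
  proof -
    let ?m = "\<lambda>X. \<Prod>i\<in>#X. coeff q i"
    have "poly q t = (\<Sum>i\<le>degree q. coeff q i * t ^ i)" by (rule poly_altdef)
    also have "\<dots> = (\<Sum>i\<le>M. coeff q i * t ^ i)"
      using q by (intro sum.mono_neutral_left) (auto simp: coeff_eq_0)
    finally have "(\<Prod>t\<in>#add_mset t T. poly q t)
        = (\<Sum>i\<le>M. coeff q i * t ^ i) * (\<Sum>X\<in>E (size T). u X * ?m X)"
      using u[OF q] by simp
    also have "\<dots> = (\<Sum>z\<in>S. h z * ?m (g z))"
      by (auto simp: sum_product sum.cartesian_product S_def h_def g_def mult_ac intro!: sum.cong)
    also have "\<dots> = (\<Sum>Y\<in>E (Suc (size T)). \<Sum>z\<in>{z\<in>S. g z = Y}. h z * ?m (g z))"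
      using fin img by (rule sum.group[symmetric])
    also have "\<dots> = (\<Sum>Y\<in>E (Suc (size T)). u' Y * ?m Y)"
      by (auto simp: u'_def sum_distrib_right intro!: sum.cong)
    finally show ?thesis .
  qed
  then show ?case by (auto simp: E_def)
qed

text \<open>
  Frankl's polynomial argument: the forms \<open>q \<mapsto> \<Prod>j\<in>B w. q(t j)\<close> of degree \<open>k\<close> in the \<open>M + 1\<close>
  coefficients of \<open>q\<close> are triangular on the polynomials with root set \<open>t ` A v\<close>, hence independent.
  The unused node \<open>0\<close> pads the forms to degree exactly \<open>k\<close>.
\<close>
lemma skew_bollobas:
  fixes A B :: "'v \<Rightarrow> 'a set" and c :: "'v \<Rightarrow> 'o :: linorder"
  assumes "finite V" "finite I" "inj_on c V"
    and sub: "\<And>v. v \<in> V \<Longrightarrow> A v \<subseteq> I" "\<And>v. v \<in> V \<Longrightarrow> B v \<subseteq> I"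
    and card: "\<And>v. v \<in> V \<Longrightarrow> card (A v) \<le> M" "\<And>v. v \<in> V \<Longrightarrow> card (B v) \<le> k"
    and disj: "\<And>v. v \<in> V \<Longrightarrow> A v \<inter> B v = {}"
    and cross: "\<And>v w. v \<in> V \<Longrightarrow> w \<in> V \<Longrightarrow> c v < c w \<Longrightarrow> A v \<inter> B w \<noteq> {}"
  shows "card V \<le> (M + k) choose M"
proof (rule ccontr)
  assume big: "\<not> card V \<le> (M + k) choose M"
  obtain e :: "'a \<Rightarrow> nat" where e: "inj_on e I"
    using finite_imp_inj_to_nat_seg[OF assms(2)] by metis
  \<comment> \<open>\<open>Suc\<close> keeps all nodes away from 0, so padding with 0 never hits a
    root of any \<open>q v\<close>.\<close>
  define t where "t = (\<lambda>a. real (Suc (e a)))"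
  have t: "inj_on t I" "\<And>a. t a \<noteq> 0" using e by (auto simp: t_def inj_on_def)
  have finA: "finite (A v)" and finB: "finite (B v)" if "v \<in> V" for v
    using sub that assms(2) finite_subset by metis+
  define q where "q = (\<lambda>v. \<Prod>a\<in>A v. [:- t a, 1:])"
  define T where "T = (\<lambda>w. image_mset t (mset_set (B w)) + replicate_mset (k - card (B w)) 0)"
  have deg: "degree (q v) \<le> M" if "v \<in> V" for v
    using card(1)[OF that] by (simp add: q_def degree_prod_sum_eq)
  have size: "size (T w) = k" if "w \<in> V" for w
    using card(2)[OF that] by (simp add: T_def)
  have root: "poly (q v) x = 0 \<longleftrightarrow> x \<in> t ` A v" if "v \<in> V" for v x
    using finA[OF that] by (auto simp: q_def poly_prod)
  have "\<exists>u. \<forall>q. degree q \<le> M \<longrightarrow> (\<Prod>x\<in>#T w. poly q x) =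
      (\<Sum>X\<in>multisets_of_size {..M} (size (T w)). u X * (\<Prod>i\<in>#X. coeff q i))" for w
    by (rule prod_poly_expansion)
  then obtain u where u: "\<And>w q. degree q \<le> M \<Longrightarrow> (\<Prod>x\<in>#T w. poly q x) =
      (\<Sum>X\<in>multisets_of_size {..M} (size (T w)). u w X * (\<Prod>i\<in>#X. coeff q i))"
    by metis
  define E where "E = multisets_of_size {..M} k"
  \<comment> \<open>There are \<open>M + 1\<close> exponents, hence \<open>(M + k) choose k\<close>
    monomials of degree \<open>k\<close>.\<close>
  have "card E = (M + k) choose M"
    by (simp add: E_def card_multisets_of_size binomial_symmetric[of k])
  then have "card E < card V" using big by simp
  moreover have "finite E" by (auto simp: E_def)
  ultimately obtain b where b: "\<exists>v\<in>V. b v \<noteq> 0" "\<forall>X\<in>E. (\<Sum>w\<in>V. b w * u w X) = 0"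
    using nontrivial_dependence[of E V u] assms(1) by blast
  let ?V' = "{v\<in>V. b v \<noteq> 0}"
  \<comment> \<open>The dependence is evaluated at \<open>q v\<close> for the \<open>c\<close>-least
    \<open>v\<close> with nonzero coefficient. Any other \<open>w\<close> with nonzero coefficient
    lies above \<open>v\<close>, so \<open>A v\<close> meets \<open>B w\<close> and a factor
    vanishes; the surviving term \<open>f v\<close> would have to be 0, against
    disjointness.\<close>
  define v where "v = arg_min_on c ?V'"
  have "finite ?V'" "?V' \<noteq> {}" using assms(1) b(1) by auto
  then have v: "v \<in> V" "b v \<noteq> 0" and min: "\<And>w. w \<in> V \<Longrightarrow> b w \<noteq> 0 \<Longrightarrow> c v \<le> c w"
    using arg_min_if_finite(1)[of ?V' c] arg_min_least[of ?V' _ c] unfolding v_def by auto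
  define f where "f = (\<lambda>w. \<Prod>x\<in>#T w. poly (q v) x)"
  have "(\<Sum>w\<in>V. b w * f w)
      = (\<Sum>w\<in>V. \<Sum>X\<in>E. (\<Prod>i\<in>#X. coeff (q v) i) * (b w * u w X))"
    by (intro sum.cong refl) (simp add: f_def u[OF deg[OF v(1)]] size E_def sum_distrib_left mult_ac)
  also have "\<dots> = (\<Sum>X\<in>E. (\<Prod>i\<in>#X. coeff (q v) i) * (\<Sum>w\<in>V. b w * u w X))"
    by (subst sum.swap) (simp add: sum_distrib_left)
  also have "\<dots> = 0" using b(2) by simp
  finally have "(\<Sum>w\<in>V. b w * f w) = 0" .
  moreover have "b w * f w = 0" if "w \<in> V - {v}" for w
  proof (cases "b w = 0")
    case False
    with that min have "c v \<le> c w" by blast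
    moreover have "c v \<noteq> c w" using that v(1) assms(3) by (auto simp: inj_on_def)
    ultimately have "A v \<inter> B w \<noteq> {}" using cross[of v w] v(1) that by auto
    then obtain a where "a \<in> A v" "a \<in> B w" by blast
    then have "t a \<in># T w" "poly (q v) (t a) = 0"
      using finB[of w] that root[OF v(1)] by (auto simp: T_def)
    then have "0 \<in># image_mset (poly (q v)) (T w)" by force
    then show ?thesis by (simp add: f_def)
  qed simp
  ultimately have "b v * f v = 0"
    using assms(1) v(1) by (simp add: sum.remove)
  then have "0 \<in> poly (q v) ` set_mset (T v)"
    using v(2) by (simp add: f_def)
  then obtain x where "x \<in># T v" "x \<in> t ` A v" using root[OF v(1)] by auto
  then obtain a where a: "a \<in> A v" "t a \<in># T v" by blast
  then have "t a \<in> t ` B v"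
    using t(2)[of a] finB[OF v(1)] by (auto simp: T_def split: if_splits)
  then have "a \<in> B v"
    using inj_on_image_mem_iff[OF t(1)] a(1) sub[OF v(1)] by blast
  with a(1) disj[OF v(1)] show False by blast
qed

section \<open>Counting the vertices of a polytope given by nonnegative coordinates\<close>

text \<open>Here \<open>card I\<close> is the number of inequalities and \<open>card K\<close> the
  dimension: \<open>param\<close> writes differences of vertices in the parameters \<open>y\<close>,
  and \<open>vertex\<close> says that no nonzero direction vanishes on all zero coordinates of a
  vertex.\<close>

lemma card_vertices_le:
  fixes V :: "('a \<Rightarrow> real) set" and \<phi> :: "'a \<Rightarrow> 'k \<Rightarrow> real"
  assumes "finite I" "finite K" "K \<noteq> {}"
    and nonneg: "\<And>v \<alpha>. v \<in> V \<Longrightarrow> \<alpha> \<in> I \<Longrightarrow> 0 \<le> v \<alpha>"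
    and zero: "\<And>v \<alpha>. v \<in> V \<Longrightarrow> \<alpha> \<notin> I \<Longrightarrow> v \<alpha> = 0"
    and param: "\<And>v w. v \<in> V \<Longrightarrow> w \<in> V \<Longrightarrow> \<exists>y. \<forall>\<alpha>\<in>I. v \<alpha> - w \<alpha> = (\<Sum>\<kappa>\<in>K. y \<kappa> * \<phi> \<alpha> \<kappa>)"
    and vertex: "\<And>v y. v \<in> V \<Longrightarrow> (\<And>\<alpha>. \<alpha> \<in> I \<Longrightarrow> v \<alpha> = 0 \<Longrightarrow> (\<Sum>\<kappa>\<in>K. y \<kappa> * \<phi> \<alpha> \<kappa>) = 0)
      \<Longrightarrow> (\<And>\<kappa>. \<kappa> \<in> K \<Longrightarrow> y \<kappa> = 0)"
  shows "card V \<le> ((card I - (card K + 1) div 2) choose (card I - card K))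
                 + ((card I - (card K + 2) div 2) choose (card I - card K))"
proof -
  define A where "A = (\<lambda>v :: 'a \<Rightarrow> real. {\<alpha>\<in>I. v \<alpha> \<noteq> 0})"
  \<comment> \<open>A vertex is determined by its support, since the difference of two vertices with
    equal support vanishes wherever they do. This yields finiteness of \<open>V\<close>.\<close>
  have "inj_on A V"
  proof (rule inj_onI)
    fix v w assume vw: "v \<in> V" "w \<in> V" "A v = A w"
    from param[OF vw(1,2)] obtain y where
      y: "\<forall>\<alpha>\<in>I. v \<alpha> - w \<alpha> = (\<Sum>\<kappa>\<in>K. y \<kappa> * \<phi> \<alpha> \<kappa>)" by blast
    have "(\<Sum>\<kappa>\<in>K. y \<kappa> * \<phi> \<alpha> \<kappa>) = 0" if "\<alpha> \<in> I" "v \<alpha> = 0" for \<alpha>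
    proof -
      have "\<alpha> \<notin> A w" using vw(3) that by (auto simp: A_def)
      then show ?thesis using y that by (auto simp: A_def)
    qed
    then have "y \<kappa> = 0" if "\<kappa> \<in> K" for \<kappa> using vertex[OF vw(1)] that by blast
    then have "\<forall>\<alpha>\<in>I. v \<alpha> - w \<alpha> = 0" using y by simp
    then show "v = w" using zero vw(1,2) by (metis eq_iff_diff_eq_0 ext)
  qed
  moreover have "finite (A ` V)"
    by (rule finite_subset[of _ "Pow I"]) (use assms(1) in \<open>auto simp: A_def\<close>)
  ultimately have finV: "finite V" using finite_imageD by blast

  \<comment> \<open>A functional that is nonzero on all these differences separates the vertices and
    so orders them strictly.\<close>
  let ?W = "(\<lambda>(v, w) \<alpha>. v \<alpha> - w \<alpha>) ` {(v, w) \<in> V \<times> V. v \<noteq> w}"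
  have "finite {(v, w) \<in> V \<times> V. v \<noteq> w}"
    by (rule finite_subset[of _ "V \<times> V"]) (use finV in auto)
  then have finW: "finite ?W" by blast
  have nzW: "\<exists>\<alpha>\<in>I. x \<alpha> \<noteq> 0" if "x \<in> ?W" for x
  proof -
    from that obtain v w where vw: "v \<in> V" "w \<in> V" "v \<noteq> w" "x = (\<lambda>\<alpha>. v \<alpha> - w \<alpha>)" by auto
    then obtain \<alpha> where "v \<alpha> \<noteq> w \<alpha>" by auto
    moreover from this have "\<alpha> \<in> I" using zero vw(1,2) by metis
    ultimately show ?thesis using vw(4) by (intro bexI[of _ \<alpha>]) auto
  qed
  obtain c where c: "\<forall>x\<in>?W. (\<Sum>\<alpha>\<in>I. c \<alpha> * x \<alpha>) \<noteq> 0"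
    using generic_functional[OF assms(1) finW nzW] ..
  define obj where "obj = (\<lambda>v. \<Sum>\<alpha>\<in>I. c \<alpha> * v \<alpha>)"
  have inj: "inj_on obj V"
  proof (rule inj_onI, rule ccontr)
    fix v w assume vw: "v \<in> V" "w \<in> V" "obj v = obj w" "v \<noteq> w"
    then have "(\<lambda>\<alpha>. v \<alpha> - w \<alpha>) \<in> ?W" by (auto intro!: image_eqI[of _ _ "(v, w)"])
    with c have "(\<Sum>\<alpha>\<in>I. c \<alpha> * (v \<alpha> - w \<alpha>)) \<noteq> 0" by (rule bspec)
    with vw(3) show False
      by (simp add: obj_def right_diff_distrib sum_subtractf)
  qed

  have "\<forall>w\<in>V. \<exists>Z r. Z \<subseteq> I \<and> card Z = card K \<and> (\<forall>\<alpha>\<in>Z. w \<alpha> = 0) \<and>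
      (\<forall>v\<in>V. obj v - obj w = (\<Sum>\<alpha>\<in>Z. r \<alpha> * v \<alpha>))"
  proof
    fix w assume w: "w \<in> V"
    have fin: "finite {\<alpha>\<in>I. w \<alpha> = 0}" using assms(1) by simp
    \<comment> \<open>The vertex condition at \<open>w\<close> is exactly the totality that lets a
      basis be picked among the coordinates vanishing at \<open>w\<close>.\<close>
    have total: "\<forall>y. (\<forall>\<alpha>\<in>{\<alpha>\<in>I. w \<alpha> = 0}. (\<Sum>\<kappa>\<in>K. y \<kappa> * \<phi> \<alpha> \<kappa>) = 0) \<longrightarrow> (\<forall>\<kappa>\<in>K. y \<kappa> = 0)"
      using vertex[OF w] by blast
    obtain Z where
      Z: "Z \<subseteq> {\<alpha>\<in>I. w \<alpha> = 0}" "card Z = card K"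
      and span: "\<And>c. \<exists>r. \<forall>\<kappa>\<in>K. c \<kappa> = (\<Sum>\<alpha>\<in>Z. r \<alpha> * \<phi> \<alpha> \<kappa>)"
      using basis_selection[OF assms(2) fin total] by auto
    from span[of "\<lambda>\<kappa>. \<Sum>\<alpha>\<in>I. c \<alpha> * \<phi> \<alpha> \<kappa>"] obtain r where
      r: "\<And>\<kappa>. \<kappa> \<in> K \<Longrightarrow> (\<Sum>\<alpha>\<in>I. c \<alpha> * \<phi> \<alpha> \<kappa>) = (\<Sum>\<alpha>\<in>Z. r \<alpha> * \<phi> \<alpha> \<kappa>)" by blast
    have "obj v - obj w = (\<Sum>\<alpha>\<in>Z. r \<alpha> * v \<alpha>)" if v: "v \<in> V" for v
    proof -
      from param[OF v w] obtain y where
        y: "\<And>\<alpha>. \<alpha> \<in> I \<Longrightarrow> v \<alpha> - w \<alpha> = (\<Sum>\<kappa>\<in>K. y \<kappa> * \<phi> \<alpha> \<kappa>)" by blast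
      have swap: "(\<Sum>\<alpha>\<in>J. b \<alpha> * (v \<alpha> - w \<alpha>)) = (\<Sum>\<kappa>\<in>K. y \<kappa> * (\<Sum>\<alpha>\<in>J. b \<alpha> * \<phi> \<alpha> \<kappa>))"
        if "J \<subseteq> I" for J b
      proof -
        have "(\<Sum>\<alpha>\<in>J. b \<alpha> * (v \<alpha> - w \<alpha>)) = (\<Sum>\<alpha>\<in>J. \<Sum>\<kappa>\<in>K. y \<kappa> * (b \<alpha> * \<phi> \<alpha> \<kappa>))"
          using that by (intro sum.cong refl) (auto simp: y sum_distrib_left mult_ac)
        also have "\<dots> = (\<Sum>\<kappa>\<in>K. y \<kappa> * (\<Sum>\<alpha>\<in>J. b \<alpha> * \<phi> \<alpha> \<kappa>))"
          by (subst sum.swap) (simp add: sum_distrib_left)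
        finally show ?thesis .
      qed
      have "obj v - obj w = (\<Sum>\<alpha>\<in>I. c \<alpha> * (v \<alpha> - w \<alpha>))"
        by (simp add: obj_def right_diff_distrib sum_subtractf)
      also have "\<dots> = (\<Sum>\<kappa>\<in>K. y \<kappa> * (\<Sum>\<alpha>\<in>Z. r \<alpha> * \<phi> \<alpha> \<kappa>))"
        by (simp add: swap r)
      also have "\<dots> = (\<Sum>\<alpha>\<in>Z. r \<alpha> * (v \<alpha> - w \<alpha>))"
        using Z(1) by (intro swap[symmetric]) auto
      \<comment> \<open>All coordinates in \<open>Z\<close> vanish at \<open>w\<close>, so only
        \<open>v\<close> remains.\<close>
      also have "\<dots> = (\<Sum>\<alpha>\<in>Z. r \<alpha> * v \<alpha>)"
        using Z(1) by (intro sum.cong) auto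
      finally show ?thesis .
    qed
    then show "\<exists>Z r. Z \<subseteq> I \<and> card Z = card K \<and> (\<forall>\<alpha>\<in>Z. w \<alpha> = 0) \<and>
      (\<forall>v\<in>V. obj v - obj w = (\<Sum>\<alpha>\<in>Z. r \<alpha> * v \<alpha>))"
      using Z by (intro exI[of _ Z] exI[of _ r]) auto
  qed
  from bchoice[OF this] obtain Z where
    "\<forall>w\<in>V. \<exists>r. Z w \<subseteq> I \<and> card (Z w) = card K \<and> (\<forall>\<alpha>\<in>Z w. w \<alpha> = 0) \<and>
      (\<forall>v\<in>V. obj v - obj w = (\<Sum>\<alpha>\<in>Z w. r \<alpha> * v \<alpha>))" ..
  from bchoice[OF this] obtain r where
    "\<forall>w\<in>V. Z w \<subseteq> I \<and> card (Z w) = card K \<and> (\<forall>\<alpha>\<in>Z w. w \<alpha> = 0) \<and>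
      (\<forall>v\<in>V. obj v - obj w = (\<Sum>\<alpha>\<in>Z w. r w \<alpha> * v \<alpha>))" ..
  then have
    Z: "\<And>w. w \<in> V \<Longrightarrow> Z w \<subseteq> I" "\<And>w. w \<in> V \<Longrightarrow> card (Z w) = card K"
       "\<And>w \<alpha>. w \<in> V \<Longrightarrow> \<alpha> \<in> Z w \<Longrightarrow> w \<alpha> = 0"
    and obj: "\<And>v w. v \<in> V \<Longrightarrow> w \<in> V \<Longrightarrow> obj v - obj w = (\<Sum>\<alpha>\<in>Z w. r w \<alpha> * v \<alpha>)"
    by auto
  have finZ: "finite (Z w)" if "w \<in> V" for w
    using Z(1)[OF that] assms(1) finite_subset by blast
  define R where "R = (\<lambda>w. {\<alpha>\<in>Z w. r w \<alpha> < 0})"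
  define R' where "R' = (\<lambda>w. {\<alpha>\<in>Z w. r w \<alpha> \<ge> 0})"
  let ?M = "card I - card K" and ?D = "card K"
  have D: "?D > 0" using assms(2,3) by (simp add: card_gt_0_iff)

  have cardA: "card (A v) \<le> ?M" if "v \<in> V" for v
  proof -
    have "card (A v) \<le> card (I - Z v)"
      using Z(3)[OF that] assms(1) by (intro card_mono) (auto simp: A_def)
    then show ?thesis using Z(1,2)[OF that] finZ[OF that] by (simp add: card_Diff_subset)
  qed
  have subI: "A w \<subseteq> I" "R w \<subseteq> I" "R' w \<subseteq> I"
    and disj: "A w \<inter> R w = {}" "A w \<inter> R' w = {}" if "w \<in> V" for w
    using Z(1,3)[OF that] by (auto simp: A_def R_def R'_def)
  have cardR: "card (R w) + card (R' w) = ?D" if "w \<in> V" for w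
  proof -
    have "card (R w \<union> R' w) = card (R w) + card (R' w)"
      using finZ[OF that] by (intro card_Un_disjoint) (auto simp: R_def R'_def)
    moreover have "R w \<union> R' w = Z w" by (auto simp: R_def R'_def)
    ultimately show ?thesis using Z(2)[OF that] by simp
  qed
  have cross: "A v \<inter> R w \<noteq> {}" if vw: "v \<in> V" "w \<in> V" "obj v < obj w" for v w
  proof
    assume "A v \<inter> R w = {}"
    then have "r w \<alpha> * v \<alpha> \<ge> 0" if "\<alpha> \<in> Z w" for \<alpha>
      using nonneg[OF vw(1)] Z(1)[OF vw(2)] that by (cases "r w \<alpha> < 0") (auto simp: A_def R_def)
    then have "obj v - obj w \<ge> 0" unfolding obj[OF vw(1,2)] by (rule sum_nonneg)
    with vw(3) show False by simp
  qed
  have cross': "A v \<inter> R' w \<noteq> {}" if vw: "v \<in> V" "w \<in> V" "obj w < obj v" for v w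
  proof
    assume "A v \<inter> R' w = {}"
    then have "r w \<alpha> * v \<alpha> \<le> 0" if "\<alpha> \<in> Z w" for \<alpha>
      using nonneg[OF vw(1)] Z(1)[OF vw(2)] that
      by (cases "r w \<alpha> < 0") (auto simp: A_def R'_def mult_nonpos_nonneg)
    then have "obj v - obj w \<le> 0" unfolding obj[OF vw(1,2)] by (rule sum_nonpos)
    with vw(3) show False by simp
  qed

  \<comment> \<open>The sizes of \<open>R v\<close> and \<open>R' v\<close> add up to
    \<open>?D\<close>, so \<open>card (R v) > ?D div 2\<close> forces
    \<open>card (R' v) \<le> (?D - 1) div 2\<close>; the two classes cover \<open>V\<close>.\<close>
  let ?V1 = "{v\<in>V. card (R v) \<le> ?D div 2}" and ?V2 = "{v\<in>V. card (R' v) \<le> (?D - 1) div 2}"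
  have V1: "card ?V1 \<le> (?M + ?D div 2) choose ?M"
    by (rule skew_bollobas[of _ I obj A R])
      (use finV assms(1) subI disj cardA cross in \<open>auto intro: inj_on_subset[OF inj]\<close>)
  have V2: "card ?V2 \<le> (?M + (?D - 1) div 2) choose ?M"
    \<comment> \<open>Negating \<open>obj\<close> reverses the order, matching the direction of
      \<open>cross'\<close>.\<close>
    by (rule skew_bollobas[of _ I "\<lambda>v. - obj v" A R'])
      (use finV assms(1) subI disj cardA cross' inj in \<open>auto simp: inj_on_def\<close>)
  have "V \<subseteq> ?V1 \<union> ?V2"
  proof
    fix v assume "v \<in> V"
    with cardR[OF this] D show "v \<in> ?V1 \<union> ?V2" by auto
  qed
  then have "card V \<le> card (?V1 \<union> ?V2)"
    using finV by (intro card_mono) auto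
  also have "\<dots> \<le> card ?V1 + card ?V2" by (rule card_Un_le)
  finally have le: "card V \<le> card ?V1 + card ?V2" .
  show ?thesis
  \<comment> \<open>A vertex \<open>v\<close> supplies \<open>Z v\<close> inside \<open>I\<close>,
    hence \<open>?D \<le> card I\<close>, under which the truncated subtractions may be
    rearranged.\<close>
  proof (cases "V = {}")
    case False
    then obtain v where "v \<in> V" by blast
    with Z(1,2) have "?D \<le> card I" using assms(1) by (metis card_mono)
    then have "?M + ?D div 2 = card I - (?D + 1) div 2"
      "?M + (?D - 1) div 2 = card I - (?D + 2) div 2"
      using D by linarith+
    with le V1 V2 show ?thesis by simp
  qed simp
qed

section \<open>Matrices with vanishing line sums and their coordinates\<close>

text \<open>The homogeneous version of the line conditions in \<open>polystochastic\<close>: the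
  directions along which these conditions are preserved.\<close>

definition line_sums_zero :: "nat \<Rightarrow> nat \<Rightarrow> ((nat \<Rightarrow> nat) \<Rightarrow> real) \<Rightarrow> bool" where
  "line_sums_zero n d x \<longleftrightarrow>
    (\<forall>\<alpha>\<in>index_set n d. \<forall>k\<in>{1..d}. (\<Sum>i\<in>{1..n}. x (\<alpha>(k := i))) = 0)"

text \<open>The tensor product of the vectors \<open>e\<^bsub>\<kappa> k\<^esub> - e\<^sub>n\<close>, \<open>k = 1, \<dots>, d\<close>.\<close>
definition corner_matrix :: "nat \<Rightarrow> nat \<Rightarrow> (nat \<Rightarrow> nat) \<Rightarrow> (nat \<Rightarrow> nat) \<Rightarrow> real" where
  "corner_matrix n d \<kappa> \<alpha> = (\<Prod>k\<in>{1..d}. of_bool (\<alpha> k = \<kappa> k) - of_bool (\<alpha> k = n))"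

lemma finite_index_set [simp]: "finite (index_set n d)"
  and card_index_set: "card (index_set n d) = n ^ d"
  by (simp_all add: index_set_def finite_PiE card_PiE)

lemma index_set_memD: "\<alpha> \<in> index_set n d \<Longrightarrow> k \<in> {1..d} \<Longrightarrow> \<alpha> k \<in> {1..n}"
  by (auto simp: index_set_def)

lemma index_set_upd: "\<alpha> \<in> index_set n d \<Longrightarrow> k \<in> {1..d} \<Longrightarrow> i \<in> {1..n} \<Longrightarrow> \<alpha>(k := i) \<in> index_set n d"
  by (auto simp: index_set_def PiE_iff extensional_def)

lemma index_set_mono: "m \<le> n \<Longrightarrow> index_set m d \<subseteq> index_set n d"
  unfolding index_set_def by (rule PiE_mono) auto

text \<open>Along a line in direction \<open>k\<close> only the \<open>k\<close>-th tensor factor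
  varies, and its entries sum to 1 - 1 = 0.\<close>

lemma line_sums_zero_corner_matrix:
  assumes "\<kappa> \<in> index_set (n - 1) d"
  shows "line_sums_zero n d (corner_matrix n d \<kappa>)"
  unfolding line_sums_zero_def
proof (intro ballI)
  fix \<alpha> k assume k: "k \<in> {1..d}"
  let ?g = "\<lambda>a j. of_bool (a = \<kappa> j) - of_bool (a = n) :: real"
  have \<kappa>: "\<kappa> k \<in> {1..n}" "n \<in> {1..n}"
    using index_set_memD[OF assms k] by auto
  have "corner_matrix n d \<kappa> (\<alpha>(k := i)) = ?g i k * (\<Prod>j\<in>{1..d} - {k}. ?g (\<alpha> j) j)" for i
  proof -
    have "corner_matrix n d \<kappa> (\<alpha>(k := i)) = ?g i k * (\<Prod>j\<in>{1..d} - {k}. ?g ((\<alpha>(k := i)) j) j)"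
      unfolding corner_matrix_def by (subst prod.remove[OF _ k]) auto
    also have "(\<Prod>j\<in>{1..d} - {k}. ?g ((\<alpha>(k := i)) j) j) = (\<Prod>j\<in>{1..d} - {k}. ?g (\<alpha> j) j)"
      by (rule prod.cong) auto
    finally show ?thesis .
  qed
  moreover have "(\<Sum>i\<in>{1..n}. ?g i k) = 0"
    using \<kappa> by (simp add: sum_subtractf of_bool_def)
  ultimately show "(\<Sum>i\<in>{1..n}. corner_matrix n d \<kappa> (\<alpha>(k := i))) = 0"
    by (simp flip: sum_distrib_right)
qed

text \<open>No index in the corner has a coordinate \<open>n\<close>, so the product reduces to
  Kronecker deltas. Thus the corner entries of a combination of corner matrices are its
  coefficients.\<close>

lemma corner_matrix_delta:
  assumes "\<kappa> \<in> index_set (n - 1) d" "\<alpha> \<in> index_set (n - 1) d"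
  shows "corner_matrix n d \<kappa> \<alpha> = of_bool (\<alpha> = \<kappa>)"
proof (cases "\<alpha> = \<kappa>")
  case True
  have "\<kappa> k \<noteq> n" if "k \<in> {1..d}" for k
    using index_set_memD[OF assms(1) that] by auto
  with True show ?thesis by (simp add: corner_matrix_def)
next
  case False
  then obtain k where k: "k \<in> {1..d}" "\<alpha> k \<noteq> \<kappa> k"
    using assms unfolding index_set_def by (meson PiE_ext)
  moreover have "\<alpha> k \<noteq> n"
    using index_set_memD[OF assms(2) k(1)] by auto
  ultimately have "\<exists>k\<in>{1..d}. of_bool (\<alpha> k = \<kappa> k) - of_bool (\<alpha> k = n) = (0 :: real)"
    by (intro bexI[of _ k]) auto
  with False show ?thesis by (simp add: corner_matrix_def prod_zero_iff)
qed

lemma line_sums_zero_sum: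
  assumes "\<And>\<kappa>. \<kappa> \<in> K \<Longrightarrow> line_sums_zero n d (f \<kappa>)"
  shows "line_sums_zero n d (\<lambda>\<alpha>. \<Sum>\<kappa>\<in>K. y \<kappa> * f \<kappa> \<alpha>)"
  unfolding line_sums_zero_def
proof (intro ballI)
  fix \<alpha> k assume "\<alpha> \<in> index_set n d" "k \<in> {1..d}"
  then have "(\<Sum>i\<in>{1..n}. f \<kappa> (\<alpha>(k := i))) = 0" if "\<kappa> \<in> K" for \<kappa>
    using assms[OF that] by (auto simp: line_sums_zero_def)
  then show "(\<Sum>i\<in>{1..n}. \<Sum>\<kappa>\<in>K. y \<kappa> * f \<kappa> (\<alpha>(k := i))) = 0"
    by (subst sum.swap) (simp flip: sum_distrib_left)
qed

lemma line_sums_zero_diff: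
  "line_sums_zero n d x \<Longrightarrow> line_sums_zero n d y \<Longrightarrow> line_sums_zero n d (\<lambda>\<alpha>. x \<alpha> - y \<alpha>)"
  by (simp add: line_sums_zero_def sum_subtractf)

text \<open>Induction on the number of coordinates equal to \<open>n\<close>: on the line through
  such a coordinate every other entry has fewer of them and vanishes, so the line sum forces the
  last entry to vanish too.\<close>

lemma line_sums_zero_eq_0:
  assumes x: "line_sums_zero n d x"
    and corner: "\<And>\<kappa>. \<kappa> \<in> index_set (n - 1) d \<Longrightarrow> x \<kappa> = 0"
    and "\<alpha> \<in> index_set n d"
  shows "x \<alpha> = 0"
  using assms(3)
proof (induction "card {k\<in>{1..d}. \<alpha> k = n}" arbitrary: \<alpha> rule: less_induct)
  case less
  show ?case
  proof (cases "\<exists>k\<in>{1..d}. \<alpha> k = n")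
    case False
    have "\<alpha> k \<in> {1..n - 1}" if "k \<in> {1..d}" for k
    proof -
      have "\<alpha> k \<in> {1..n}" "\<alpha> k \<noteq> n" using less.prems that False by (auto simp: index_set_def PiE_iff)
      then show ?thesis by auto
    qed
    then have "\<alpha> \<in> index_set (n - 1) d"
      using less.prems by (auto simp: index_set_def PiE_iff)
    then show ?thesis by (rule corner)
  next
    case True
    then obtain k where k: "k \<in> {1..d}" "\<alpha> k = n" by blast
    then have n: "n \<in> {1..n}" using less.prems by (auto simp: index_set_def PiE_iff)
    have "x (\<alpha>(k := i)) = 0" if i: "i \<in> {1..n} - {n}" for i
    proof (rule less.hyps)
      show "card {j\<in>{1..d}. (\<alpha>(k := i)) j = n} < card {k\<in>{1..d}. \<alpha> k = n}"
        using k i by (intro psubset_card_mono) auto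
      show "\<alpha>(k := i) \<in> index_set n d"
        using index_set_upd[OF less.prems k(1)] i by blast
    qed
    then have "(\<Sum>i\<in>{1..n}. x (\<alpha>(k := i))) = x (\<alpha>(k := n))"
      by (subst sum.remove[OF _ n]) auto
    moreover have "\<alpha>(k := n) = \<alpha>" using k(2) by auto
    moreover have "(\<Sum>i\<in>{1..n}. x (\<alpha>(k := i))) = 0"
      using x less.prems k(1) unfolding line_sums_zero_def by blast
    ultimately show ?thesis by simp
  qed
qed

text \<open>Both sides have zero line sums and agree on the corner, so their difference vanishes.
  The corner entries thus give \<open>(n - 1) ^ d\<close> free parameters.\<close>

lemma line_sums_zero_expansion:
  assumes "line_sums_zero n d x" "\<alpha> \<in> index_set n d"
  shows "x \<alpha> = (\<Sum>\<kappa>\<in>index_set (n - 1) d. x \<kappa> * corner_matrix n d \<kappa> \<alpha>)"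
proof -
  let ?s = "\<lambda>\<alpha>. \<Sum>\<kappa>\<in>index_set (n - 1) d. x \<kappa> * corner_matrix n d \<kappa> \<alpha>"
  have "line_sums_zero n d (\<lambda>\<alpha>. x \<alpha> - ?s \<alpha>)"
    by (intro line_sums_zero_diff line_sums_zero_sum line_sums_zero_corner_matrix assms)
  moreover have "?s \<beta> = x \<beta>" if "\<beta> \<in> index_set (n - 1) d" for \<beta>
    using that by (simp add: corner_matrix_delta of_bool_def if_distrib cong: sum.cong if_cong)
  ultimately have "x \<alpha> - ?s \<alpha> = 0"
    using assms(2) line_sums_zero_eq_0[of n d "\<lambda>\<alpha>. x \<alpha> - ?s \<alpha>"] by simp
  then show ?thesis by simp
qed

section \<open>Extreme points of the polytope and the final bound\<close>

text \<open>If \<open>x\<close> were nonzero, small steps from \<open>v\<close> along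
  \<open>x\<close> and \<open>- x\<close> would stay in the polytope, making \<open>v\<close> the
  midpoint of two distinct points.\<close>

lemma extreme_pt_Omega_rigid:
  assumes ext: "extreme_pt (Omega n d) v" and x: "line_sums_zero n d x"
    and supp: "\<And>\<alpha>. \<alpha> \<in> index_set n d \<Longrightarrow> v \<alpha> = 0 \<Longrightarrow> x \<alpha> = 0"
    and \<alpha>: "\<alpha> \<in> index_set n d"
  shows "x \<alpha> = 0"
proof (rule ccontr)
  assume "x \<alpha> \<noteq> 0"
  let ?I = "index_set n d"
  have v: "v \<in> Omega n d" using ext by (simp add: extreme_pt_def)
  then have v0: "\<And>\<beta>. \<beta> \<notin> ?I \<Longrightarrow> v \<beta> = 0" and v_nonneg: "\<And>\<beta>. \<beta> \<in> ?I \<Longrightarrow> 0 \<le> v \<beta>"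
    by (auto simp: Omega_def polystochastic_def matrices_def)
  \<comment> \<open>A step size that keeps both perturbed matrices nonnegative. It is positive
    because \<open>supp\<close> makes \<open>v\<close> positive wherever \<open>x\<close> is
    nonzero.\<close>
  define e where "e = Min (insert 1 ((\<lambda>\<beta>. v \<beta> / \<bar>x \<beta>\<bar>) ` {\<beta>\<in>?I. x \<beta> \<noteq> 0}))"
  have e_le: "e * \<bar>x \<beta>\<bar> \<le> v \<beta>" if "\<beta> \<in> ?I" for \<beta>
  proof (cases "x \<beta> = 0")
    case False
    with that have "e \<le> v \<beta> / \<bar>x \<beta>\<bar>" unfolding e_def by (intro Min_le) auto
    with False show ?thesis by (simp add: field_simps)
  qed (use v_nonneg that in auto)
  have "0 < v \<beta> / \<bar>x \<beta>\<bar>" if "\<beta> \<in> ?I" "x \<beta> \<noteq> 0" for \<beta>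
    using that supp v_nonneg by (metis zero_less_abs_iff divide_pos_pos order_le_less)
  then have e: "0 < e" unfolding e_def by (subst Min_gr_iff) auto
  \<comment> \<open>\<open>x\<close> is unconstrained off the index set, so the perturbation is cut
    off there to remain in \<open>matrices\<close>.\<close>
  define pt where "pt = (\<lambda>s \<beta>. if \<beta> \<in> ?I then v \<beta> + s * x \<beta> else 0)"
  have pt: "pt s \<in> Omega n d" if s: "\<bar>s\<bar> = e" for s
  proof -
    have "0 \<le> v \<beta> + s * x \<beta>" if "\<beta> \<in> ?I" for \<beta>
    proof -
      have "\<bar>s * x \<beta>\<bar> \<le> v \<beta>" using e_le[OF that] s by (simp add: abs_mult)
      then show ?thesis by linarith
    qed
    moreover have "(\<Sum>i\<in>{1..n}. pt s (\<beta>(k := i))) = 1" if "\<beta> \<in> ?I" "k \<in> {1..d}" for \<beta> k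
    proof -
      have "(\<Sum>i\<in>{1..n}. pt s (\<beta>(k := i))) = (\<Sum>i\<in>{1..n}. v (\<beta>(k := i)) + s * x (\<beta>(k := i)))"
        using index_set_upd[OF that] by (intro sum.cong) (auto simp: pt_def)
      also have "\<dots> = (\<Sum>i\<in>{1..n}. v (\<beta>(k := i))) + s * (\<Sum>i\<in>{1..n}. x (\<beta>(k := i)))"
        by (simp add: sum.distrib sum_distrib_left)
      also have "\<dots> = 1"
        using v x that by (auto simp: Omega_def polystochastic_def line_sums_zero_def)
      finally show ?thesis .
    qed
    ultimately show ?thesis
      by (auto simp: Omega_def polystochastic_def matrices_def pt_def)
  qed
  have "pt e \<noteq> pt (- e)"
  proof
    assume "pt e = pt (- e)"
    then have "pt e \<alpha> = pt (- e) \<alpha>" by simp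
    with \<open>x \<alpha> \<noteq> 0\<close> e \<alpha> show False by (simp add: pt_def)
  qed
  moreover have "v = (\<lambda>\<beta>. 1/2 * pt e \<beta> + (1 - 1/2) * pt (- e) \<beta>)"
    by (auto simp: pt_def v0 fun_eq_iff field_simps)
  moreover have "pt e \<in> Omega n d" "pt (- e) \<in> Omega n d" using pt e by auto
  moreover have "(0 :: real) < 1/2" "(1/2 :: real) < 1" by simp_all
  ultimately show False using ext unfolding extreme_pt_def by blast
qed

theorem theorem1:
  fixes n d :: nat
  assumes "n \<ge> 3" and "d \<ge> 2"
  shows "num_vertices n d \<le>
           ((n ^ d - ((n - 1) ^ d + 1) div 2) choose (n ^ d - (n - 1) ^ d))
         + ((n ^ d - ((n - 1) ^ d + 2) div 2) choose (n ^ d - (n - 1) ^ d))"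
proof -
  let ?I = "index_set n d" and ?K = "index_set (n - 1) d"
  let ?V = "{A. extreme_pt (Omega n d) A}"
  have V: "polystochastic n d v" if "v \<in> ?V" for v
    using that by (simp add: extreme_pt_def Omega_def)
  have "card ?K > 0" using assms(1) by (simp add: card_index_set)
  then have "?K \<noteq> {}" by auto
  have "card ?V \<le> ((card ?I - (card ?K + 1) div 2) choose (card ?I - card ?K))
                 + ((card ?I - (card ?K + 2) div 2) choose (card ?I - card ?K))"
  \<comment> \<open>The corner entries serve as parameters, so the dimension is
    \<open>(n - 1) ^ d\<close> and the inequalities are the \<open>n ^ d\<close> entries.\<close>
  proof (rule card_vertices_le[where \<phi> = "\<lambda>\<alpha> \<kappa>. corner_matrix n d \<kappa> \<alpha>"])
    fix v w assume "v \<in> ?V" "w \<in> ?V"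
    then have "line_sums_zero n d (\<lambda>\<alpha>. v \<alpha> - w \<alpha>)"
      using V[of v] V[of w] by (simp add: line_sums_zero_def polystochastic_def sum_subtractf)
    then show "\<exists>y. \<forall>\<alpha>\<in>?I. v \<alpha> - w \<alpha> = (\<Sum>\<kappa>\<in>?K. y \<kappa> * corner_matrix n d \<kappa> \<alpha>)"
      by (intro exI ballI) (rule line_sums_zero_expansion)
  next
    fix v y \<beta>
    assume v: "v \<in> ?V" and \<beta>: "\<beta> \<in> ?K"
      and supp: "\<And>\<alpha>. \<alpha> \<in> ?I \<Longrightarrow> v \<alpha> = 0 \<Longrightarrow> (\<Sum>\<kappa>\<in>?K. y \<kappa> * corner_matrix n d \<kappa> \<alpha>) = 0"
    let ?x = "\<lambda>\<alpha>. \<Sum>\<kappa>\<in>?K. y \<kappa> * corner_matrix n d \<kappa> \<alpha>"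
    have "line_sums_zero n d ?x"
      by (intro line_sums_zero_sum line_sums_zero_corner_matrix)
    moreover have "\<beta> \<in> ?I" using \<beta> index_set_mono[of "n - 1" n d] by auto
    ultimately have "?x \<beta> = 0"
      using extreme_pt_Omega_rigid[of n d v ?x] v supp by blast
    \<comment> \<open>The corner entries of \<open>?x\<close> recover its coefficients, so rigidity
      of \<open>v\<close> kills \<open>y\<close>.\<close>
    moreover have "?x \<beta> = y \<beta>"
      using \<beta> by (simp add: corner_matrix_delta of_bool_def if_distrib cong: sum.cong if_cong)
    ultimately show "y \<beta> = 0" by simp
  qed (use V \<open>?K \<noteq> {}\<close> in \<open>auto simp: polystochastic_def matrices_def\<close>)
  then show ?thesis by (simp only: num_vertices_def card_index_set)
qed

end
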